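(* Let $\alpha_{\min}\le\alpha_{\max}$ be finite real numbers and let $\alpha_0\in[\alpha_{\min},\alpha_{\max}]$ be the (fixed) true parameter. For each number of vertices $n_V$, let $\hat\alpha$ denote the maximum likelihood estimator of $\alpha_0$ based on a single network $Y\sim p_{\alpha_0}$ (using the likelihood $\alpha\mapsto p_\alpha(Y)$), and let $\hat\alpha^{\dagger}$ denote the maximum likelihood estimator of $\alpha_0$ based on a single network $Y\sim p^{\dagger}_{\alpha_0}$ (using the likelihood $\alpha\mapsto p^{\dagger}_\alpha(Y)$). Then, as $n_V\to\infty$: (i) under the model $p_{\alpha_0}$, the estimator $\hat\alpha$ is $\binom{n_V}{2}^{1/2}$-consistent for $\alpha_0$, and $$\binom{n_V}{2}^{1/2}(\hat\alpha-\alpha_0)\;\longrightarrow\; N\left(0,\left\{\frac{2e^{\alpha_0}}{(1+e^{\alpha_0})^2}\right\}^{-1}\right)\quad\text{in distribution};$$ (ii) under the model $p^{\dagger}_{\alpha_0}$, the estimator $\hat\alpha^{\dagger}$ is $n_V^{1/2}$-consistent for $\alpha_0$, and $$\sqrt{n_V}\,(\hat\alpha^{\dagger}-\alpha_0)\;\longrightarrow\; N\left(0,e^{-\alpha_0}\right)\quad\text{in distribution}.$$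
   Context: A directed network (no self-loops) on the vertex set $\{1,\dots,n_V\}$ is represented by its adjacency matrix $Y=(Y_{ij})\in\{0,1\}^{n_V\times n_V}$ with $Y_{ii}=0$ for all $i$; $Y_{ij}=1$ means there is a tie $(i,j)$. The Bernoulli model $p_\alpha$, $\alpha\in\mathbb{R}$, is the probability distribution on such matrices given by $$p_\alpha(Y=y)=\prod_{i<j}\frac{\exp\{\alpha(y_{ij}+y_{ji})\}}{1+2e^{\alpha}+e^{2\alpha}}.$$ The sparse (offset) Bernoulli model $p^{\dagger}_\alpha$ is the same model with $\alpha$ replaced by $\alpha-\log n_V$: $$p^{\dagger}_\alpha(Y=y)=p_{\alpha-\log n_V}(Y=y)=\prod_{i<j}\frac{\exp\{(\alpha-\log n_V)(y_{ij}+y_{ji})\}}{1+2e^{\alpha}/n_V+e^{2\alpha}/n_V^2}.$$ A maximum likelihood estimator is a maximizer over $\alpha\in\mathbb{R}$ of the likelihood of the observed network; on the event that no maximizer exists (the network has no ties or all possible ties) it may be assigned an arbitrary value. An estimator $\hat\theta$ is $r_n$-consistent for $\theta_0$ if $r_n(\hat\theta-\theta_0)=O_P(1)$ as $n_V\to\infty$. $N(\mu,\sigma^2)$ denotes the normal distribution with mean $\mu$ and variance $\sigma^2$. *)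

theory Defs
  imports "HOL-Probability.Probability"
begin

text \<open>
  An \<open>n\<close>-vertex network is its adjacency matrix, encoded as a function on all pairs of naturals
  that vanishes outside \<open>{1..n} \<times> {1..n}\<close>, so that distinct functions are distinct networks.
\<close>

definition networks :: "nat \<Rightarrow> (nat \<Rightarrow> nat \<Rightarrow> nat) set" where
  "networks n = {y. (\<forall>i j. y i j \<in> {0, 1}) \<and> (\<forall>i. y i i = 0) \<and>
                    (\<forall>i j. i \<notin> {1..n} \<or> j \<notin> {1..n} \<longrightarrow> y i j = 0)}"

definition dyads :: "nat \<Rightarrow> (nat \<times> nat) set" where
  "dyads n = {(i, j). i \<in> {1..n} \<and> j \<in> {1..n} \<and> i < j}"

definition bernoulli_lik :: "nat \<Rightarrow> real \<Rightarrow> (nat \<Rightarrow> nat \<Rightarrow> nat) \<Rightarrow> real" where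
  "bernoulli_lik n \<alpha> y =
     (\<Prod>(i, j)\<in>dyads n. exp (\<alpha> * real (y i j + y j i)) / (1 + 2 * exp \<alpha> + exp (2 * \<alpha>)))"

definition sparse_bernoulli_lik :: "nat \<Rightarrow> real \<Rightarrow> (nat \<Rightarrow> nat \<Rightarrow> nat) \<Rightarrow> real" where
  "sparse_bernoulli_lik n \<alpha> y = bernoulli_lik n (\<alpha> - ln (real n)) y"

definition bernoulli_model :: "nat \<Rightarrow> real \<Rightarrow> (nat \<Rightarrow> nat \<Rightarrow> nat) measure" where
  "bernoulli_model n \<alpha> = point_measure (networks n) (\<lambda>y. ennreal (bernoulli_lik n \<alpha> y))"

definition sparse_bernoulli_model :: "nat \<Rightarrow> real \<Rightarrow> (nat \<Rightarrow> nat \<Rightarrow> nat) measure" where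
  "sparse_bernoulli_model n \<alpha> =
     point_measure (networks n) (\<lambda>y. ennreal (sparse_bernoulli_lik n \<alpha> y))"

text \<open>The value of the estimator is unconstrained at observations whose likelihood has no maximizer.\<close>

definition is_mle :: "'y set \<Rightarrow> (real \<Rightarrow> 'y \<Rightarrow> real) \<Rightarrow> ('y \<Rightarrow> real) \<Rightarrow> bool" where
  "is_mle S L est \<longleftrightarrow>
     (\<forall>y\<in>S. (\<exists>\<alpha>. is_arg_max (\<lambda>\<alpha>. L \<alpha> y) (\<lambda>_. True) \<alpha>) \<longrightarrow>
             is_arg_max (\<lambda>\<alpha>. L \<alpha> y) (\<lambda>_. True) (est y))"

text \<open>\<open>X n = O\<^sub>P(1)\<close>, where \<open>X n\<close> lives on its own probability space \<open>M n\<close>.\<close>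

definition bounded_in_probability :: "(nat \<Rightarrow> 'a measure) \<Rightarrow> (nat \<Rightarrow> 'a \<Rightarrow> real) \<Rightarrow> bool" where
  "bounded_in_probability M X \<longleftrightarrow>
     (\<forall>\<epsilon>>0. \<exists>C. \<forall>\<^sub>F n in sequentially.
        measure (M n) {\<omega> \<in> space (M n). \<bar>X n \<omega>\<bar> > C} < \<epsilon>)"

definition rate_consistent ::
  "(nat \<Rightarrow> real) \<Rightarrow> (nat \<Rightarrow> 'a measure) \<Rightarrow> (nat \<Rightarrow> 'a \<Rightarrow> real) \<Rightarrow> real \<Rightarrow> bool" where
  "rate_consistent r M est \<theta>\<^sub>0 \<longleftrightarrow> bounded_in_probability M (\<lambda>n \<omega>. r n * (est n \<omega> - \<theta>\<^sub>0))"

text \<open>Parametrized by the variance, whereas \<^const>\<open>normal_density\<close> takes the standard deviation.\<close>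

definition normal_distribution :: "real \<Rightarrow> real \<Rightarrow> real measure" where
  "normal_distribution \<mu> v = density lborel (normal_density \<mu> (sqrt v))"

definition converges_in_distribution ::
  "(nat \<Rightarrow> 'a measure) \<Rightarrow> (nat \<Rightarrow> 'a \<Rightarrow> real) \<Rightarrow> real measure \<Rightarrow> bool" where
  "converges_in_distribution M X N \<longleftrightarrow> weak_conv_m (\<lambda>n. distr (M n) borel (X n)) N"

lemma sparse_bernoulli_lik_explicit:
  assumes "n > 0"
  shows "sparse_bernoulli_lik n \<alpha> y =
    (\<Prod>(i, j)\<in>dyads n. exp ((\<alpha> - ln (real n)) * real (y i j + y j i)) /
        (1 + 2 * exp \<alpha> / real n + exp (2 * \<alpha>) / (real n)\<^sup>2))"
proof -
  have "exp (2 * (\<alpha> - ln (real n))) = exp (2 * \<alpha>) / (real n)\<^sup>2"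
    using assms by (simp add: right_diff_distrib exp_diff exp_double)
  then show ?thesis
    using assms by (simp add: sparse_bernoulli_lik_def bernoulli_lik_def exp_diff)
qed

lemma finite_dyads: "finite (dyads n)"
  by (rule finite_subset[of _ "{1..n} \<times> {1..n}"]) (auto simp: dyads_def)

lemma bij_betw_networks:
  "bij_betw (\<lambda>y. \<lambda>p\<in>dyads n. (y (fst p) (snd p), y (snd p) (fst p))) (networks n)
     (dyads n \<rightarrow>\<^sub>E {0, 1} \<times> {0, 1})"
proof -
  define F :: "(nat \<Rightarrow> nat \<Rightarrow> nat) \<Rightarrow> nat \<times> nat \<Rightarrow> nat \<times> nat" where
    "F = (\<lambda>y. \<lambda>p\<in>dyads n. (y (fst p) (snd p), y (snd p) (fst p)))"
  define G :: "(nat \<times> nat \<Rightarrow> nat \<times> nat) \<Rightarrow> nat \<Rightarrow> nat \<Rightarrow> nat" where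
    "G = (\<lambda>g i j. if (i, j) \<in> dyads n then fst (g (i, j))
                  else if (j, i) \<in> dyads n then snd (g (j, i)) else 0)"
  have asym: "(j, i) \<notin> dyads n" if "(i, j) \<in> dyads n" for i j
    using that by (simp add: dyads_def)
  have "bij_betw F (networks n) (dyads n \<rightarrow>\<^sub>E {0, 1} \<times> {0, 1})"
  proof (rule bij_betw_byWitness[where f' = G]; intro ballI image_subsetI)
    fix y assume y: "y \<in> networks n"
    have "y i j = 0" if "(i, j) \<notin> dyads n" "(j, i) \<notin> dyads n" for i j
    proof (cases "i \<in> {1..n} \<and> j \<in> {1..n}")
      case True
      with that have "i = j"
        by (simp add: dyads_def)
      then show ?thesis
        using y by (simp add: networks_def)
    next
      case False
      then show ?thesis
        using y unfolding networks_def by blast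
    qed
    then show "G (F y) = y"
      by (intro ext) (simp add: F_def G_def)
  next
    fix g :: "nat \<times> nat \<Rightarrow> nat \<times> nat" assume g: "g \<in> dyads n \<rightarrow>\<^sub>E {0, 1} \<times> {0, 1}"
    show "F (G g) = g"
    proof
      fix p
      show "F (G g) p = g p"
      proof (cases "p \<in> dyads n")
        case True
        then show ?thesis
          by (cases p) (simp add: F_def G_def asym)
      next
        case False
        then show ?thesis
          using PiE_arb[OF g] by (simp add: F_def)
      qed
    qed
  next
    fix y assume y: "y \<in> networks n"
    then have "y i j \<in> {0, 1}" for i j
      unfolding networks_def by blast
    then show "F y \<in> dyads n \<rightarrow>\<^sub>E {0, 1} \<times> {0, 1}"
      unfolding F_def by (intro restrict_PiE_iff[THEN iffD2] ballI SigmaI)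
  next
    fix g :: "nat \<times> nat \<Rightarrow> nat \<times> nat" assume g: "g \<in> dyads n \<rightarrow>\<^sub>E {0, 1} \<times> {0, 1}"
    have "fst (g p) \<in> {0, 1}" "snd (g p) \<in> {0, 1}" if "p \<in> dyads n" for p
      using PiE_mem[OF g that] by (simp_all only: mem_Times_iff)
    then have "G g i j \<in> {0, 1}" for i j
      unfolding G_def by (simp only: split: if_splits) simp
    moreover have "G g i i = 0" for i
      by (simp add: G_def dyads_def)
    moreover have "G g i j = 0" if "i \<notin> {1..n} \<or> j \<notin> {1..n}" for i j
    proof -
      have "(i, j) \<notin> dyads n" "(j, i) \<notin> dyads n"
        using that unfolding dyads_def by blast+
      then show ?thesis
        by (simp add: G_def)
    qed
    ultimately show "G g \<in> networks n"
      unfolding networks_def by blast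
  qed
  then show ?thesis
    by (simp only: F_def)
qed

lemma finite_networks: "finite (networks n)"
  using bij_betw_finite[OF bij_betw_networks, of n] by (simp add: finite_PiE finite_dyads)

lemma bernoulli_lik_pos: "bernoulli_lik n \<alpha> y > 0"
  unfolding bernoulli_lik_def by (rule prod_pos) (auto intro!: divide_pos_pos add_pos_pos)

lemma sum_bernoulli_lik: "(\<Sum>y\<in>networks n. bernoulli_lik n \<alpha> y) = 1"
proof -
  let ?Z = "1 + 2 * exp \<alpha> + exp (2 * \<alpha>)"
  let ?f = "\<lambda>(a, b). exp (\<alpha> * real (a + b)) / ?Z"
  have Z: "?Z > 0"
    by (intro add_pos_pos) auto
  have e2: "exp (\<alpha> * 2) = exp (2 * \<alpha>)"
    by (simp add: mult.commute)
  have "(\<Sum>y\<in>networks n. bernoulli_lik n \<alpha> y)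
      = (\<Sum>y\<in>networks n. \<Prod>p\<in>dyads n. ?f ((\<lambda>p\<in>dyads n. (y (fst p) (snd p), y (snd p) (fst p))) p))"
    unfolding bernoulli_lik_def by (intro sum.cong prod.cong refl) auto
  also have "\<dots> = (\<Sum>g\<in>dyads n \<rightarrow>\<^sub>E {0, 1} \<times> {0, 1}. \<Prod>p\<in>dyads n. ?f (g p))"
    by (rule sum.reindex_bij_betw[OF bij_betw_networks])
  also have "\<dots> = (\<Prod>p\<in>dyads n. \<Sum>q\<in>{0, 1} \<times> {0, 1}. ?f q)"
    by (rule prod_sum_PiE[symmetric]) (auto simp: finite_dyads)
  also have "(\<Sum>q\<in>{0, 1} \<times> {0, 1}. ?f q) = ?Z / ?Z"
    by (simp add: sum.cartesian_product[symmetric] e2 add_divide_distrib[symmetric])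
  finally show ?thesis
    using Z by simp
qed

lemma prob_space_bernoulli_model: "prob_space (bernoulli_model n \<alpha>)"
proof (rule prob_spaceI)
  show "emeasure (bernoulli_model n \<alpha>) (space (bernoulli_model n \<alpha>)) = 1"
    unfolding bernoulli_model_def
    by (simp add: space_point_measure emeasure_point_measure_finite finite_networks
        less_imp_le[OF bernoulli_lik_pos] sum_bernoulli_lik)
qed

lemma sparse_bernoulli_model_eq:
  "sparse_bernoulli_model n \<alpha> = bernoulli_model n (\<alpha> - ln (real n))"
  by (simp add: sparse_bernoulli_model_def bernoulli_model_def sparse_bernoulli_lik_def)

lemma prob_space_sparse_bernoulli_model: "prob_space (sparse_bernoulli_model n \<alpha>)"
  by (simp add: sparse_bernoulli_model_eq prob_space_bernoulli_model)

end

theory Submission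
  imports Defs "HOL-Real_Asymp.Real_Asymp"
begin

text \<open>
  The likelihood of an \<open>n\<close>-vertex network depends on it only through its number of ties \<open>T\<close>, which
  under the natural parameter \<open>a\<close> is a binomial variable with \<open>N = n (n - 1)\<close> trials and success
  probability \<open>p = logistic a\<close>. Both models are instances of one: the parameter is \<open>\<theta>\<close>, the natural
  parameter is \<open>a = \<theta> - c\<^sub>n\<close>, and the offset \<open>c\<^sub>n\<close> is \<open>0\<close> or \<open>ln n\<close>. Write \<open>s\<^sub>n = sqrt (N p (1 - p))\<close>
  for the standard deviation of \<open>T\<close> and \<open>Z\<^sub>n = (T - N p) / s\<^sub>n\<close>.

  Three facts carry the proof.

  \<^item> \<open>Z\<^sub>n\<close> is asymptotically standard normal as soon as \<open>s\<^sub>n\<close> tends to infinity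
    (\<open>standardized_ties_clt\<close>). Since \<open>p\<close> may vary with \<open>n\<close>, this is a statement about a triangular
    array. The characteristic function of \<open>Z\<^sub>n\<close> is an explicit \<open>N\<close>-th power, which is compared with
    \<open>(1 - t\<^sup>2 / (2 N))\<^sup>N\<close>; Levy's continuity theorem does the rest.

  \<^item> If \<open>0 < T < N\<close>, the maximum likelihood estimate \<open>e\<close> solves \<open>N logistic (e - c\<^sub>n) = T\<close>
    (\<open>mle_score_equation\<close>). As \<open>logistic\<close> is increasing, \<open>r\<^sub>n (e - \<theta>) \<le> x\<close> is then the same event as
    \<open>T \<le> N logistic (a + x / r\<^sub>n)\<close>, that is \<open>Z\<^sub>n \<le> z\<^sub>n\<close> for an explicit number \<open>z\<^sub>n\<close>
    (\<open>mle_le_iff_standardized_ties_le\<close>). This replaces the usual Taylor expansion of the score. If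
    \<open>s\<^sub>n / r\<^sub>n\<close> tends to \<open>\<kappa>\<close>, then \<open>z\<^sub>n\<close> tends to \<open>\<kappa> x\<close> (\<open>critical_value_tendsto\<close>), so the
    distribution function of \<open>r\<^sub>n (e - \<theta>)\<close> tends to that of the normal law with variance
    \<open>1 / \<kappa>\<^sup>2\<close>.

  \<^item> The networks with \<open>T = 0\<close> or \<open>T = N\<close>, on which the estimate is arbitrary, satisfy
    \<open>\<bar>Z\<^sub>n\<bar> \<ge> s\<^sub>n\<close> (\<open>boundary_imp_standardized_ties_large\<close>). Their probability vanishes, because
    \<open>Z\<^sub>n\<close> is bounded in probability and \<open>s\<^sub>n\<close> tends to infinity.

  Consistency at the rate \<open>r\<^sub>n\<close> is a consequence of convergence in distribution. The two rates come
  from the size of \<open>s\<^sub>n\<^sup>2\<close>: without offset it is \<open>n choose 2\<close> times \<open>2 exp \<theta> / (1 + exp \<theta>)\<^sup>2\<close>, whereas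
  the offset \<open>ln n\<close> makes \<open>p\<close> of order \<open>exp \<theta> / n\<close> and \<open>s\<^sub>n\<^sup>2\<close> asymptotic to \<open>n exp \<theta>\<close>.
\<close>

section \<open>A central limit theorem for binomial characteristic functions\<close>

text \<open>
  A centred Bernoulli variable with success probability \<open>p\<close> takes the value \<open>- p\<close> with probability
  \<open>1 - p\<close> and the value \<open>1 - p\<close> with probability \<open>p\<close>. Its mean is \<open>0\<close>, so the second-order Taylor
  polynomial of its characteristic function at \<open>u\<close> has only the variance term. The error is kept
  proportional to the variance \<open>p (1 - p)\<close>: this makes the bound useful even when \<open>p\<close> tends to \<open>0\<close>.
\<close>

lemma two_point_char_approx:
  fixes p u :: real
  assumes "0 \<le> p" "p \<le> 1"
  shows "cmod ((1 - p) * iexp (- u * p) + p * iexp (u * (1 - p)) - (1 - u\<^sup>2 * (p * (1 - p)) / 2))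
    \<le> \<bar>u\<bar> ^ 3 * (p * (1 - p)) / 6"
proof -
  define R :: "real \<Rightarrow> complex" where "R x = iexp x - (1 + \<i> * x - x\<^sup>2 / 2)" for x
  have R: "cmod (R x) \<le> \<bar>x\<bar> ^ 3 / 6" for x
    using iexp_approx1[of x 2]
    by (simp add: R_def numeral_eq_Suc power_mult_distrib algebra_simps)
  have q: "0 \<le> 1 - p"
    using assms by simp
  have "p\<^sup>2 + (1 - p)\<^sup>2 \<le> 1"
  proof -
    have "0 \<le> p * (1 - p)"
      using assms q by (intro mult_nonneg_nonneg) auto
    then show ?thesis
      by (simp add: power2_eq_square algebra_simps)
  qed
  then have *: "p * (1 - p) * (p\<^sup>2 + (1 - p)\<^sup>2) \<le> p * (1 - p)"
    using assms by (intro mult_left_le) auto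
  have "(1 - p) * iexp (- u * p) + p * iexp (u * (1 - p)) - (1 - u\<^sup>2 * (p * (1 - p)) / 2)
      = (1 - p) * R (- u * p) + p * R (u * (1 - p))"
    by (simp add: R_def field_simps power2_eq_square)
  also have "cmod \<dots> \<le> (1 - p) * cmod (R (- u * p)) + p * cmod (R (u * (1 - p)))"
    using assms q norm_triangle_ineq[of "complex_of_real (1 - p) * R (- u * p)" "p * R (u * (1 - p))"]
    by (simp only: norm_mult norm_of_real abs_of_nonneg)
  also have "\<dots> \<le> (1 - p) * (\<bar>- u * p\<bar> ^ 3 / 6) + p * (\<bar>u * (1 - p)\<bar> ^ 3 / 6)"
    using assms q by (intro add_mono mult_left_mono R)
  also have "\<dots> = \<bar>u\<bar> ^ 3 * (p * (1 - p) * (p\<^sup>2 + (1 - p)\<^sup>2)) / 6"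
    using assms q by (simp add: abs_mult power_mult_distrib) (simp add: field_simps power2_eq_square power3_eq_cube)
  also have "\<dots> \<le> \<bar>u\<bar> ^ 3 * (p * (1 - p)) / 6"
    using * by (intro divide_right_mono mult_left_mono) auto
  finally show ?thesis .
qed

lemma two_point_char_le_1:
  fixes p u :: real
  assumes "0 \<le> p" "p \<le> 1"
  shows "cmod ((1 - p) * iexp (- u * p) + p * iexp (u * (1 - p))) \<le> 1"
proof -
  have "cmod ((1 - p) * iexp (- u * p) + p * iexp (u * (1 - p)))
      \<le> cmod ((1 - p) * iexp (- u * p)) + cmod (p * iexp (u * (1 - p)))"
    by (rule norm_triangle_ineq)
  also have "\<dots> = \<bar>1 - p\<bar> + \<bar>p\<bar>"
    unfolding norm_mult norm_exp_i_times norm_of_real by simp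
  finally show ?thesis
    using assms by simp
qed

text \<open>
  With \<open>u = t / s\<close> the variance term of the two-point approximation is exactly \<open>t\<^sup>2 / (2 N)\<close>. Taking
  \<open>N\<close>-th powers of numbers in the unit disc multiplies the error by at most \<open>N\<close>, and \<open>N\<close> times the
  third-order bound is of order \<open>1 / s\<close>. The bound depends on \<open>p\<close> and \<open>N\<close> only
  through \<open>s\<close>, which is why sparse and dense regimes can be treated together.
\<close>

lemma standardized_binomial_char_tendsto:
  fixes p :: "nat \<Rightarrow> real" and N :: "nat \<Rightarrow> nat" and t :: real
  assumes p: "\<And>n. 0 \<le> p n" "\<And>n. p n \<le> 1"
    and s: "s = (\<lambda>n. sqrt (real (N n) * (p n * (1 - p n))))"
    and lim: "filterlim s at_top sequentially"
  shows "(\<lambda>n. ((1 - p n) * iexp (- (t / s n) * p n) + p n * iexp (t / s n * (1 - p n))) ^ N n)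
    \<longlonglongrightarrow> complex_of_real (exp (- t\<^sup>2 / 2))"
proof -
  let ?\<psi> = "\<lambda>n. (1 - p n) * iexp (- (t / s n) * p n) + p n * iexp (t / s n * (1 - p n))"
  let ?w = "\<lambda>n. 1 + (- t\<^sup>2 / 2) / real (N n)"
  have pq: "0 \<le> p n * (1 - p n)" "p n * (1 - p n) \<le> 1" for n
    using p[of n] by (auto intro: mult_le_one)
  have s_sq: "(s n)\<^sup>2 = real (N n) * (p n * (1 - p n))" for n
    using pq[of n] by (simp add: s)
  have N: "filterlim (\<lambda>n. real (N n)) at_top sequentially"
  proof (rule filterlim_at_top_mono)
    show "filterlim (\<lambda>n. s n * s n) at_top sequentially"
      by (intro filterlim_at_top_mult_at_top lim)
    show "\<forall>\<^sub>F n in sequentially. s n * s n \<le> real (N n)"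
      using s_sq pq by (auto simp: power2_eq_square mult_left_le)
  qed
  have "\<forall>\<^sub>F n in sequentially. s n > 0"
    using lim unfolding filterlim_at_top_dense by blast
  moreover have "\<forall>\<^sub>F n in sequentially. real (N n) \<ge> max 1 (t\<^sup>2 / 4)"
    using N unfolding filterlim_at_top by blast
  ultimately have bound: "\<forall>\<^sub>F n in sequentially.
      cmod (?\<psi> n ^ N n - complex_of_real (?w n ^ N n)) \<le> (\<bar>t\<bar> ^ 3 / 6) * inverse (s n)"
  proof eventually_elim
    case (elim n)
    then have pos: "s n > 0" "real (N n) > 0" "real (N n) \<ge> t\<^sup>2 / 4"
      by auto
    have var: "(t / s n)\<^sup>2 * (p n * (1 - p n)) = t\<^sup>2 / N n"
    proof -
      have "p n * (1 - p n) = (s n)\<^sup>2 / N n"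
        using s_sq[of n] pos by simp
      then show ?thesis
        using pos by (simp add: power_divide)
    qed
    \<comment> \<open>By the choice of the bound \<open>t\<^sup>2 / 4\<close> for \<open>N n\<close>, \<open>?w n\<close> does not fall below \<open>- 1\<close>.\<close>
    have w: "\<bar>?w n\<bar> \<le> 1"
      using pos by (simp add: abs_le_iff field_simps)
    then have w': "cmod (complex_of_real (?w n)) \<le> 1"
      by (simp only: norm_of_real)
    have w_eq: "?w n = 1 - (t / s n)\<^sup>2 * (p n * (1 - p n)) / 2"
      by (simp only: var) simp
    have "cmod (?\<psi> n ^ N n - complex_of_real (?w n) ^ N n) \<le> N n * cmod (?\<psi> n - complex_of_real (?w n))"
      by (rule norm_power_diff[OF two_point_char_le_1[OF p] w'])
    also have "\<dots> \<le> N n * (\<bar>t / s n\<bar> ^ 3 * (p n * (1 - p n)) / 6)"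
      unfolding w_eq by (intro mult_left_mono two_point_char_approx p) simp
    also have "\<dots> = \<bar>t\<bar> ^ 3 * (s n)\<^sup>2 / (s n) ^ 3 / 6"
      using pos unfolding s_sq by (simp add: power_divide)
    also have "\<dots> = (\<bar>t\<bar> ^ 3 / 6) * inverse (s n)"
      using pos by (simp add: field_simps power2_eq_square power3_eq_cube)
    finally show ?case
      by simp
  qed
  have "(\<lambda>n. (\<bar>t\<bar> ^ 3 / 6) * inverse (s n)) \<longlonglongrightarrow> 0"
    by (rule tendsto_mult_right_zero[OF tendsto_inverse_0_at_top[OF lim]])
  then have "(\<lambda>n. ?\<psi> n ^ N n - complex_of_real (?w n ^ N n)) \<longlonglongrightarrow> 0"
    by (rule Lim_null_comparison[OF bound])
  moreover have "(\<lambda>n. complex_of_real (?w n ^ N n)) \<longlonglongrightarrow> complex_of_real (exp (- t\<^sup>2 / 2))"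
  proof (rule tendsto_of_real)
    have "filterlim N at_top sequentially"
      using N by (simp add: filterlim_sequentially_iff_filterlim_real)
    from filterlim_compose[OF tendsto_exp_limit_sequentially this]
    show "(\<lambda>n. ?w n ^ N n) \<longlonglongrightarrow> exp (- t\<^sup>2 / 2)" .
  qed
  ultimately show ?thesis
    by (rule Lim_transform[rotated])
qed

section \<open>The number of ties\<close>

definition ties :: "nat \<Rightarrow> (nat \<Rightarrow> nat \<Rightarrow> nat) \<Rightarrow> nat" where
  "ties n y = (\<Sum>(i, j)\<in>dyads n. y i j + y j i)"

definition logistic :: "real \<Rightarrow> real" where
  "logistic \<alpha> = exp \<alpha> / (1 + exp \<alpha>)"

lemma one_plus_exp_pos: "1 + exp \<alpha> > (0::real)"
  by (simp add: add_pos_pos)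

lemma logistic_bounds: "0 < logistic \<alpha>" "logistic \<alpha> < 1"
  using one_plus_exp_pos[of \<alpha>] by (simp_all add: logistic_def)

lemma one_minus_logistic: "1 - logistic \<alpha> = 1 / (1 + exp \<alpha>)"
  using one_plus_exp_pos[of \<alpha>] by (simp add: logistic_def field_simps)

lemma logistic_le_iff: "logistic a \<le> logistic b \<longleftrightarrow> a \<le> b"
proof -
  have "logistic a \<le> logistic b \<longleftrightarrow> 1 / (1 + exp b) \<le> 1 / (1 + exp a)"
    using one_minus_logistic[of a] one_minus_logistic[of b] by linarith
  also have "\<dots> \<longleftrightarrow> a \<le> b"
    using one_plus_exp_pos[of a] one_plus_exp_pos[of b] by (simp add: field_simps)
  finally show ?thesis .
qed

lemma logistic_logit:
  fixes t m :: real
  assumes "0 < t" "t < m"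
  shows "m * logistic (ln (t / (m - t))) = t"
proof -
  have "1 + t / (m - t) = m / (m - t)"
    using assms by (simp add: field_simps)
  then show ?thesis
    using assms by (simp add: logistic_def)
qed

lemma card_dyads: "card (dyads n) = n choose 2"
proof (induction n)
  case 0
  then show ?case
    by (simp add: dyads_def)
next
  case (Suc n)
  have "dyads (Suc n) = dyads n \<union> (\<lambda>i. (i, Suc n)) ` {1..n}"
    by (auto simp: dyads_def)
  moreover have "card (dyads n \<union> (\<lambda>i. (i, Suc n)) ` {1..n}) = card (dyads n) + card ((\<lambda>i. (i, Suc n)) ` {1..n})"
    by (rule card_Un_disjoint) (use finite_dyads in \<open>auto simp: dyads_def\<close>)
  ultimately show ?case
    using Suc by (simp add: card_image inj_on_def numeral_2_eq_2)
qed

lemma bernoulli_lik_eq: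
  "bernoulli_lik n \<alpha> y = exp (\<alpha> * ties n y) / (1 + exp \<alpha>) ^ (2 * (n choose 2))"
proof -
  have "1 + 2 * exp \<alpha> + exp (2 * \<alpha>) = (1 + exp \<alpha>)\<^sup>2"
    by (simp add: power2_sum exp_double)
  then have "bernoulli_lik n \<alpha> y
      = (\<Prod>p\<in>dyads n. exp (\<alpha> * real (y (fst p) (snd p) + y (snd p) (fst p)))) / ((1 + exp \<alpha>)\<^sup>2) ^ card (dyads n)"
    by (simp add: bernoulli_lik_def case_prod_beta prod_dividef)
  also have "(\<Prod>p\<in>dyads n. exp (\<alpha> * real (y (fst p) (snd p) + y (snd p) (fst p)))) = exp (\<alpha> * ties n y)"
    by (simp add: exp_sum[OF finite_dyads, symmetric] ties_def sum_distrib_left case_prod_beta)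
  finally show ?thesis
    by (simp add: card_dyads power_mult)
qed

text \<open>
  The left-hand side is the probability generating function of the number of ties. The likelihood
  and \<open>z ^ ties n y\<close> are both products over dyads, so the sum over networks factors into one sum over
  the four states of each dyad. The result is the generating function of a binomial distribution.
\<close>

lemma pgf_ties:
  fixes z :: complex
  shows "(\<Sum>y\<in>networks n. bernoulli_lik n \<alpha> y * z ^ ties n y)
    = (1 - logistic \<alpha> + logistic \<alpha> * z) ^ (2 * (n choose 2))"
proof -
  let ?D = "(1 + exp \<alpha>)\<^sup>2"
  let ?f = "\<lambda>(a, b). complex_of_real (exp (\<alpha> * real (a + b)) / ?D) * z ^ (a + b)"
  have D: "complex_of_real (1 + exp \<alpha>) \<noteq> 0"
    using one_plus_exp_pos[of \<alpha>] by (simp only: of_real_eq_0_iff)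
  have Z: "1 + 2 * exp \<alpha> + exp (2 * \<alpha>) = ?D"
    by (simp add: power2_sum exp_double)
  have "(\<Sum>y\<in>networks n. bernoulli_lik n \<alpha> y * z ^ ties n y)
      = (\<Sum>y\<in>networks n. \<Prod>p\<in>dyads n. ?f ((\<lambda>p\<in>dyads n. (y (fst p) (snd p), y (snd p) (fst p))) p))"
    unfolding bernoulli_lik_def ties_def Z power_sum of_real_prod prod.distrib[symmetric]
    by (intro sum.cong prod.cong refl) (simp add: case_prod_beta)
  also have "\<dots> = (\<Sum>g\<in>dyads n \<rightarrow>\<^sub>E {0, 1} \<times> {0, 1}. \<Prod>p\<in>dyads n. ?f (g p))"
    by (rule sum.reindex_bij_betw[OF bij_betw_networks])
  also have "\<dots> = (\<Prod>p\<in>dyads n. \<Sum>q\<in>{0, 1} \<times> {0, 1}. ?f q)"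
    by (rule prod_sum_PiE[symmetric]) (auto simp: finite_dyads)
  also have "(\<Sum>q\<in>{0, 1} \<times> {0, 1}. ?f q) = (1 - logistic \<alpha> + logistic \<alpha> * z)\<^sup>2"
  proof -
    have "(\<Sum>q\<in>{0, 1} \<times> {0, 1}. ?f q)
        = (1 + 2 * (exp \<alpha> * z) + (exp \<alpha> * z)\<^sup>2) / complex_of_real (1 + exp \<alpha>) ^ 2"
      by (simp add: sum.cartesian_product[symmetric] exp_add power2_eq_square algebra_simps add_divide_distrib)
    also have "\<dots> = ((1 + exp \<alpha> * z) / complex_of_real (1 + exp \<alpha>))\<^sup>2"
      by (simp add: power_divide power2_sum)
    also have "(1 + exp \<alpha> * z) / complex_of_real (1 + exp \<alpha>) = 1 - logistic \<alpha> + logistic \<alpha> * z"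
      using D by (simp add: logistic_def field_simps)
    finally show ?thesis .
  qed
  finally show ?thesis
    by (simp add: card_dyads power_mult)
qed

lemma space_bernoulli_model: "space (bernoulli_model n \<alpha>) = networks n"
  by (simp add: bernoulli_model_def space_point_measure)

lemma borel_measurable_bernoulli_model:
  fixes X :: "(nat \<Rightarrow> nat \<Rightarrow> nat) \<Rightarrow> 'a :: topological_space"
  shows "X \<in> borel_measurable (bernoulli_model n \<alpha>)"
  by (simp add: bernoulli_model_def)

definition ties_sd :: "nat \<Rightarrow> real \<Rightarrow> real" where
  "ties_sd n \<alpha> = sqrt (real (2 * (n choose 2)) * (logistic \<alpha> * (1 - logistic \<alpha>)))"

definition standardized_ties :: "nat \<Rightarrow> real \<Rightarrow> (nat \<Rightarrow> nat \<Rightarrow> nat) \<Rightarrow> real" where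
  "standardized_ties n \<alpha> y = (real (ties n y) - real (2 * (n choose 2)) * logistic \<alpha>) / ties_sd n \<alpha>"

text \<open>
  This evaluates the generating function at \<open>iexp (t / s)\<close> and distributes the phase that comes from
  centring over the \<open>N\<close> factors.
\<close>

lemma char_standardized_ties:
  "char (distr (bernoulli_model n \<alpha>) borel (standardized_ties n \<alpha>)) t
    = ((1 - logistic \<alpha>) * iexp (- (t / ties_sd n \<alpha>) * logistic \<alpha>)
        + logistic \<alpha> * iexp (t / ties_sd n \<alpha> * (1 - logistic \<alpha>))) ^ (2 * (n choose 2))"
proof -
  define u where "u = t / ties_sd n \<alpha>"
  define p where "p = logistic \<alpha>"
  define N where "N = 2 * (n choose 2)"
  have split: "iexp (t * standardized_ties n \<alpha> y) = iexp u ^ ties n y * iexp (- u * p) ^ N" for y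
    unfolding exp_of_nat_mult[symmetric] exp_add[symmetric]
    by (simp add: standardized_ties_def u_def[symmetric] p_def N_def)
       (simp add: u_def p_def algebra_simps diff_divide_distrib)
  have "char (distr (bernoulli_model n \<alpha>) borel (standardized_ties n \<alpha>)) t
      = (CLINT y|bernoulli_model n \<alpha>. iexp (t * standardized_ties n \<alpha> y))"
    unfolding char_def by (rule integral_distr) (auto simp: borel_measurable_bernoulli_model)
  also have "\<dots> = (\<Sum>y\<in>networks n. bernoulli_lik n \<alpha> y * iexp (t * standardized_ties n \<alpha> y))"
    unfolding bernoulli_model_def
    by (subst lebesgue_integral_point_measure_finite)
       (auto simp: finite_networks less_imp_le[OF bernoulli_lik_pos] scaleR_conv_of_real)
  also have "\<dots> = (\<Sum>y\<in>networks n. bernoulli_lik n \<alpha> y * iexp u ^ ties n y) * iexp (- u * p) ^ N"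
    unfolding split by (simp add: sum_distrib_right mult.assoc)
  also have "\<dots> = ((1 - p + p * iexp u) * iexp (- u * p)) ^ N"
    unfolding pgf_ties power_mult_distrib p_def N_def ..
  also have "(1 - p + p * iexp u) * iexp (- u * p) = (1 - p) * iexp (- u * p) + p * iexp (u * (1 - p))"
  proof -
    have "iexp (u * (1 - p)) = iexp u * iexp (- u * p)"
      unfolding exp_add[symmetric] by (simp add: algebra_simps)
    then show ?thesis
      by (simp only:) (simp add: algebra_simps)
  qed
  finally show ?thesis
    by (simp add: u_def p_def N_def)
qed

lemma standardized_ties_clt:
  assumes "filterlim (\<lambda>n. ties_sd n (a n)) at_top sequentially"
  shows "converges_in_distribution (\<lambda>n. bernoulli_model n (a n)) (\<lambda>n. standardized_ties n (a n))
    std_normal_distribution"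
  unfolding converges_in_distribution_def
proof (rule levy_continuity)
  show "real_distribution (distr (bernoulli_model n (a n)) borel (standardized_ties n (a n)))" for n
    by (rule prob_space.real_distribution_distr[OF prob_space_bernoulli_model borel_measurable_bernoulli_model])
  show "(\<lambda>n. char (distr (bernoulli_model n (a n)) borel (standardized_ties n (a n))) t)
      \<longlonglongrightarrow> char std_normal_distribution t" for t
    unfolding char_standardized_ties char_std_normal_distribution
    by (rule standardized_binomial_char_tendsto[OF _ _ _ assms])
       (simp_all only: logistic_bounds less_imp_le ties_sd_def)
qed (rule real_dist_normal_dist)

section \<open>Weak convergence to a distribution without atoms\<close>

text \<open>
  Pointwise convergence of monotone functions survives a moving argument: for \<open>w < z < w'\<close> close to
  \<open>z\<close> the value at \<open>zs n\<close> is eventually squeezed between those at the fixed points \<open>w\<close> and \<open>w'\<close>.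
\<close>

lemma tendsto_mono_moving_argument:
  fixes F :: "nat \<Rightarrow> real \<Rightarrow> real"
  assumes mono: "\<And>n. mono (F n)"
    and lim: "\<And>x. (\<lambda>n. F n x) \<longlonglongrightarrow> G x"
    and cont: "isCont G z"
    and z: "zs \<longlonglongrightarrow> z"
  shows "(\<lambda>n. F n (zs n)) \<longlonglongrightarrow> G z"
proof (rule order_tendstoI)
  fix l assume "l < G z"
  then have "\<forall>\<^sub>F w in at_left z. l < G w"
    using cont by (metis continuous_at_split continuous_within order_tendstoD(1))
  moreover have "\<forall>\<^sub>F w in at_left z. w < z"
    by (simp add: eventually_at_filter)
  ultimately obtain w where w: "l < G w" "w < z"
    by (metis (mono_tags, lifting) eventually_conj eventually_happens' trivial_limit_at_left_real)
  from order_tendstoD(1)[OF lim w(1)] order_tendstoD(1)[OF z w(2)]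
  show "\<forall>\<^sub>F n in sequentially. l < F n (zs n)"
    by eventually_elim (meson less_imp_le less_le_trans mono monoD)
next
  fix l assume "l > G z"
  then have "\<forall>\<^sub>F w in at_right z. l > G w"
    using cont by (metis continuous_at_split continuous_within order_tendstoD(2))
  moreover have "\<forall>\<^sub>F w in at_right z. w > z"
    by (simp add: eventually_at_filter)
  ultimately obtain w where w: "l > G w" "w > z"
    by (metis (mono_tags, lifting) eventually_conj eventually_happens' trivial_limit_at_right_real)
  from order_tendstoD(2)[OF lim w(1)] order_tendstoD(2)[OF z w(2)]
  show "\<forall>\<^sub>F n in sequentially. F n (zs n) < l"
    by eventually_elim (meson less_imp_le le_less_trans mono monoD)
qed

lemma cdf_distr_eq:
  assumes "X \<in> borel_measurable M"
  shows "cdf (distr M borel X) x = measure M {\<omega> \<in> space M. X \<omega> \<le> x}"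
  using assms by (simp add: cdf_def measure_distr vimage_def Int_def conj_commute)

lemma converges_in_distribution_prob_le:
  assumes prob: "\<And>n. prob_space (M n)"
    and X: "\<And>n. X n \<in> borel_measurable (M n)"
    and N: "real_distribution N" "\<And>x. measure N {x} = 0"
    and conv: "converges_in_distribution M X N"
    and z: "zs \<longlonglongrightarrow> z"
  shows "(\<lambda>n. measure (M n) {\<omega> \<in> space (M n). X n \<omega> \<le> zs n}) \<longlonglongrightarrow> cdf N z"
proof -
  interpret N: real_distribution N
    by fact
  have cont: "isCont (cdf N) x" for x
    using N(2) by (simp add: N.isCont_cdf)
  have "(\<lambda>n. cdf (distr (M n) borel (X n)) (zs n)) \<longlonglongrightarrow> cdf N z"
  proof (rule tendsto_mono_moving_argument[OF _ _ cont z])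
    show "mono (cdf (distr (M n) borel (X n)))" for n
    proof -
      interpret D: real_distribution "distr (M n) borel (X n)"
        by (rule prob_space.real_distribution_distr[OF prob X])
      show ?thesis
        by (intro monoI D.cdf_nondecreasing)
    qed
    show "(\<lambda>n. cdf (distr (M n) borel (X n)) x) \<longlonglongrightarrow> cdf N x" for x
      using conv cont by (simp add: converges_in_distribution_def weak_conv_m_def weak_conv_def)
  qed
  then show ?thesis
    by (simp add: cdf_distr_eq[OF X])
qed

text \<open>
  The limit law puts mass less than \<open>\<epsilon>\<close> outside some interval \<open>(- C, C]\<close>, and the distribution functions
  converge at both ends of it.
\<close>

lemma converges_in_distribution_imp_bounded_in_probability:
  assumes prob: "\<And>n. prob_space (M n)"
    and X: "\<And>n. X n \<in> borel_measurable (M n)"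
    and N: "real_distribution N" "\<And>x. measure N {x} = 0"
    and conv: "converges_in_distribution M X N"
  shows "bounded_in_probability M X"
  unfolding bounded_in_probability_def
proof (intro allI impI)
  fix \<epsilon> :: real assume "\<epsilon> > 0"
  interpret N: real_distribution N
    by fact
  have lim: "(\<lambda>n. measure (M n) {\<omega> \<in> space (M n). X n \<omega> \<le> x}) \<longlonglongrightarrow> cdf N x" for x
    by (rule converges_in_distribution_prob_le[OF prob X N conv tendsto_const])
  have "\<forall>\<^sub>F C in at_top. cdf N C > 1 - \<epsilon> / 2"
    using order_tendstoD(1)[OF N.cdf_lim_at_top_prob, of "1 - \<epsilon> / 2"] \<open>\<epsilon> > 0\<close> by simp
  moreover have "\<forall>\<^sub>F C in at_top. cdf N (- C) < \<epsilon> / 2"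
    using filterlim_compose[OF N.cdf_lim_at_bot filterlim_uminus_at_bot_at_top] \<open>\<epsilon> > 0\<close>
    by (intro order_tendstoD(2)) auto
  ultimately have "\<forall>\<^sub>F C in at_top. cdf N C > 1 - \<epsilon> / 2 \<and> cdf N (- C) < \<epsilon> / 2"
    by (rule eventually_conj)
  then obtain C where C: "cdf N C > 1 - \<epsilon> / 2" "cdf N (- C) < \<epsilon> / 2"
    by (auto simp: eventually_at_top_linorder)
  have "\<forall>\<^sub>F n in sequentially. measure (M n) {\<omega> \<in> space (M n). \<bar>X n \<omega>\<bar> > C} < \<epsilon>"
    using order_tendstoD(1)[OF lim C(1)] order_tendstoD(2)[OF lim C(2)]
  proof eventually_elim
    case (elim n)
    interpret prob_space "M n"
      by (rule prob)
    note [measurable] = X[of n]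
    have "prob {\<omega> \<in> space (M n). \<bar>X n \<omega>\<bar> > C}
        \<le> prob ({\<omega> \<in> space (M n). X n \<omega> \<le> - C} \<union> (space (M n) - {\<omega> \<in> space (M n). X n \<omega> \<le> C}))"
      by (intro finite_measure_mono) auto
    also have "\<dots> \<le> prob {\<omega> \<in> space (M n). X n \<omega> \<le> - C} + (1 - prob {\<omega> \<in> space (M n). X n \<omega> \<le> C})"
      by (rule order_trans[OF measure_Un_le]) (auto simp: prob_compl)
    finally show ?case
      using elim by simp
  qed
  then show "\<exists>C. \<forall>\<^sub>F n in sequentially. measure (M n) {\<omega> \<in> space (M n). \<bar>X n \<omega>\<bar> > C} < \<epsilon>" ..
qed

lemma bounded_in_probability_imp_tail_tendsto_0:
  assumes prob: "\<And>n. prob_space (M n)"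
    and X: "\<And>n. X n \<in> borel_measurable (M n)"
    and bdd: "bounded_in_probability M X"
    and c: "filterlim c at_top sequentially"
  shows "(\<lambda>n. measure (M n) {\<omega> \<in> space (M n). \<bar>X n \<omega>\<bar> \<ge> c n}) \<longlonglongrightarrow> 0"
proof (rule order_tendstoI)
  fix \<epsilon> :: real assume "0 < \<epsilon>"
  then obtain C where C: "\<forall>\<^sub>F n in sequentially. measure (M n) {\<omega> \<in> space (M n). \<bar>X n \<omega>\<bar> > C} < \<epsilon>"
    using bdd by (auto simp: bounded_in_probability_def)
  moreover have "\<forall>\<^sub>F n in sequentially. c n > C"
    using c by (simp add: filterlim_at_top_dense)
  ultimately show "\<forall>\<^sub>F n in sequentially. measure (M n) {\<omega> \<in> space (M n). \<bar>X n \<omega>\<bar> \<ge> c n} < \<epsilon>"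
  proof eventually_elim
    case (elim n)
    interpret prob_space "M n"
      by (rule prob)
    note [measurable] = X[of n]
    have "prob {\<omega> \<in> space (M n). \<bar>X n \<omega>\<bar> \<ge> c n} \<le> prob {\<omega> \<in> space (M n). \<bar>X n \<omega>\<bar> > C}"
      using elim(2) by (intro finite_measure_mono) auto
    with elim(1) show ?case
      by simp
  qed
qed (auto intro!: always_eventually less_le_trans[OF _ measure_nonneg])

lemma measure_density_lborel_singleton:
  assumes "f \<in> borel_measurable borel"
  shows "measure (density lborel f) {x} = 0"
proof -
  have "AE y in lborel. f y * indicator {x} y = 0"
    using AE_lborel_singleton[of x] by eventually_elim simp
  then have "emeasure (density lborel f) {x} = 0"
    using assms by (simp add: emeasure_density nn_integral_0_iff_AE)
  then show ?thesis
    by (simp add: measure_def)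
qed

lemma cdf_normal_distribution:
  assumes "\<kappa> > 0"
  shows "cdf (normal_distribution 0 (inverse (\<kappa>\<^sup>2))) x = cdf std_normal_distribution (\<kappa> * x)"
proof -
  interpret prob_space std_normal_distribution
    by (rule prob_space_normal_density) simp
  have sd: "sqrt (inverse (\<kappa>\<^sup>2)) = inverse \<kappa>"
    using assms by (simp add: real_sqrt_inverse)
  have "distributed std_normal_distribution lborel (\<lambda>x. x) std_normal_density"
    by (simp add: distributed_def distr_id2)
  from normal_density_affine[OF this, of "inverse \<kappa>" 0] assms
  have "distributed std_normal_distribution lborel (\<lambda>x. inverse \<kappa> * x) (normal_density 0 (inverse \<kappa>))"
    by simp
  then have "normal_distribution 0 (inverse (\<kappa>\<^sup>2)) = distr std_normal_distribution lborel (\<lambda>x. inverse \<kappa> * x)"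
    by (simp add: normal_distribution_def sd distributed_distr_eq_density)
  moreover have "inverse \<kappa> * y \<le> x \<longleftrightarrow> y \<le> \<kappa> * x" for y
    using assms by (simp add: field_simps)
  ultimately show ?thesis
    by (simp add: cdf_def measure_distr vimage_def atMost_def)
qed

section \<open>The score equation\<close>

lemma ties_le:
  assumes "y \<in> networks n"
  shows "ties n y \<le> 2 * (n choose 2)"
proof -
  have "y i j \<le> 1" for i j
  proof -
    have "y i j \<in> {0, 1}"
      using assms unfolding networks_def by blast
    then show ?thesis
      by auto
  qed
  then have "y i j + y j i \<le> 2" for i j
    using add_mono[of "y i j" 1 "y j i" 1] by simp
  then have "ties n y \<le> (\<Sum>p\<in>dyads n. 2)"
    unfolding ties_def by (intro sum_mono) (simp add: case_prod_beta)
  then show ?thesis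
    by (simp add: card_dyads)
qed

text \<open>
  This is Gibbs' inequality. Up to the factor \<open>N\<close>, the log-likelihood at \<open>\<alpha>\<close> is minus the cross entropy of the
  Bernoulli laws with success probabilities \<open>logistic \<beta> = T / N\<close> and \<open>logistic \<alpha>\<close>, and it is
  maximal only where the two laws agree. Strictness comes from \<open>ln x < x - 1\<close> for \<open>x \<noteq> 1\<close>.
\<close>

lemma bernoulli_lik_less_mle:
  assumes score: "real (2 * (n choose 2)) * logistic \<beta> = real (ties n y)"
    and ties: "0 < ties n y" and "\<alpha> \<noteq> \<beta>"
  shows "bernoulli_lik n \<alpha> y < bernoulli_lik n \<beta> y"
proof -
  define N where "N = 2 * (n choose 2)"
  have score: "real N * logistic \<beta> = real (ties n y)"
    using score by (simp only: N_def)
  have N: "real N > 0"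
    using score ties by (cases "N = 0") auto
  let ?p = "logistic \<alpha>" and ?q = "logistic \<beta>"
  have ln_lik: "ln (bernoulli_lik n \<gamma> y) = real N * (?q * ln (logistic \<gamma>) + (1 - ?q) * ln (1 - logistic \<gamma>))" for \<gamma>
  proof -
    have ln_p: "ln (logistic \<gamma>) = \<gamma> - ln (1 + exp \<gamma>)"
      using one_plus_exp_pos[of \<gamma>] by (simp add: logistic_def ln_div)
    have ln_q: "ln (1 - logistic \<gamma>) = - ln (1 + exp \<gamma>)"
      using one_plus_exp_pos[of \<gamma>] unfolding one_minus_logistic by (simp add: ln_div)
    have "real N * (?q * ln (logistic \<gamma>) + (1 - ?q) * ln (1 - logistic \<gamma>))
        = real N * ?q * ln (logistic \<gamma>) + (real N - real N * ?q) * ln (1 - logistic \<gamma>)"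
      by (simp add: algebra_simps)
    also have "\<dots> = \<gamma> * ties n y - N * ln (1 + exp \<gamma>)"
      unfolding score ln_p ln_q by (simp add: algebra_simps)
    also have "\<dots> = ln (bernoulli_lik n \<gamma> y)"
      using one_plus_exp_pos[of \<gamma>] by (simp add: bernoulli_lik_eq ln_div ln_realpow N_def)
    finally show ?thesis ..
  qed
  have neq: "?p \<noteq> ?q"
    using logistic_le_iff[of \<alpha> \<beta>] logistic_le_iff[of \<beta> \<alpha>] \<open>\<alpha> \<noteq> \<beta>\<close> by auto
  have less: "ln x < x - 1" if "x > 0" "x \<noteq> 1" for x :: real
    using ln_le_minus_one[of x] ln_eq_minus_one[of x] that by fastforce
  have "ln ?p - ln ?q = ln (?p / ?q)" "ln (1 - ?p) - ln (1 - ?q) = ln ((1 - ?p) / (1 - ?q))"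
    using logistic_bounds[of \<alpha>] logistic_bounds[of \<beta>] by (simp_all add: ln_div)
  moreover have "ln (?p / ?q) < ?p / ?q - 1" "ln ((1 - ?p) / (1 - ?q)) < (1 - ?p) / (1 - ?q) - 1"
    using logistic_bounds[of \<alpha>] logistic_bounds[of \<beta>] neq by (auto intro!: less)
  ultimately have "?q * (ln ?p - ln ?q) + (1 - ?q) * (ln (1 - ?p) - ln (1 - ?q))
      < ?q * (?p / ?q - 1) + (1 - ?q) * ((1 - ?p) / (1 - ?q) - 1)"
    using logistic_bounds[of \<beta>] by (intro add_strict_mono mult_strict_left_mono) auto
  also have "\<dots> = (?p - ?q) + ((1 - ?p) - (1 - ?q))"
  proof -
    have "b * (a / b - 1) = a - b" if "b \<noteq> 0" for a b :: real
      using that by (simp add: right_diff_distrib)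
    then show ?thesis
      using logistic_bounds[of \<beta>] by (intro arg_cong2[where f = "(+)"]) auto
  qed
  also have "\<dots> = 0"
    by simp
  finally have "ln (bernoulli_lik n \<alpha> y) < ln (bernoulli_lik n \<beta> y)"
    unfolding ln_lik using N by (intro mult_strict_left_mono) (auto simp: algebra_simps)
  then show ?thesis
    by (simp add: bernoulli_lik_pos)
qed

text \<open>
  The logit of \<open>T / N\<close> is a maximizer, so the estimate has to be one too, and there is only
  one.
\<close>

lemma mle_score_equation:
  assumes est: "is_mle (networks n) (\<lambda>\<alpha>. bernoulli_lik n (\<alpha> - c)) est"
    and y: "y \<in> networks n" and ties: "0 < ties n y" "ties n y < 2 * (n choose 2)"
  shows "real (2 * (n choose 2)) * logistic (est y - c) = real (ties n y)"
proof -
  let ?N = "real (2 * (n choose 2))" and ?T = "real (ties n y)"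
  define \<beta> where "\<beta> = ln (?T / (?N - ?T))"
  have pos: "?T > 0" "?N - ?T > 0"
    using ties by (simp_all only: of_nat_0_less_iff diff_gt_0_iff_gt of_nat_less_iff)
  then have score: "?N * logistic \<beta> = ?T"
    unfolding \<beta>_def by (intro logistic_logit) auto
  have max: "bernoulli_lik n (\<alpha> - c) y < bernoulli_lik n \<beta> y" if "\<alpha> \<noteq> \<beta> + c" for \<alpha>
    using that by (intro bernoulli_lik_less_mle[OF score ties(1)]) auto
  then have "is_arg_max (\<lambda>\<alpha>. bernoulli_lik n (\<alpha> - c) y) (\<lambda>_. True) (\<beta> + c)"
    unfolding is_arg_max_def by (metis add_diff_cancel_right' less_asym)
  then have "is_arg_max (\<lambda>\<alpha>. bernoulli_lik n (\<alpha> - c) y) (\<lambda>_. True) (est y)"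
    using est y by (auto simp: is_mle_def)
  then have "est y = \<beta> + c"
    using max[of "est y"] unfolding is_arg_max_def by (metis add_diff_cancel_right')
  with score show ?thesis
    by simp
qed

section \<open>Asymptotic normality\<close>

text \<open>
  An exact form of the first-order expansion of \<open>logistic\<close>: the fraction is \<open>h\<close> up to terms of second
  order, with an error that is uniform in \<open>a\<close>.
\<close>

lemma logistic_diff:
  "logistic (a + h) - logistic a
    = logistic a * (1 - logistic a) * ((exp h - 1) / (1 + logistic a * (exp h - 1)))"
proof -
  define e f where "e = exp a" and "f = exp h"
  have pos: "e > 0" "f > 0"
    by (simp_all add: e_def f_def)
  then have "1 + e > 0" "1 + e * f > 0"
    by (simp_all add: add_pos_pos)
  moreover have "1 + e / (1 + e) * (f - 1) = (1 + e * f) / (1 + e)"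
    using \<open>1 + e > 0\<close> by (simp add: field_simps)
  ultimately show ?thesis
    unfolding one_minus_logistic unfolding logistic_def exp_add e_def[symmetric] f_def[symmetric]
    by (simp only:) (simp add: divide_simps, simp add: algebra_simps)
qed

text \<open>
  An empty or complete network has a deviation \<open>\<bar>T - N p\<bar>\<close> of \<open>N p\<close> or \<open>N (1 - p)\<close>, and both are at least
  the variance \<open>N p (1 - p)\<close>.
\<close>

lemma boundary_imp_standardized_ties_large:
  assumes "ties_sd n \<alpha> > 0" and "ties n y = 0 \<or> ties n y = 2 * (n choose 2)"
  shows "ties_sd n \<alpha> \<le> \<bar>standardized_ties n \<alpha> y\<bar>"
proof -
  define m where "m = real (2 * (n choose 2))"
  let ?p = "logistic \<alpha>"
  have p: "0 < ?p" "0 < 1 - ?p" "?p < 1"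
    using logistic_bounds[of \<alpha>] by simp_all
  have m: "m \<ge> 0"
    by (simp add: m_def)
  have "(ties_sd n \<alpha>)\<^sup>2 = m * (?p * (1 - ?p))"
    using p m by (simp add: ties_sd_def m_def)
  also have "\<dots> \<le> \<bar>real (ties n y) - m * ?p\<bar>"
  proof (rule disjE[OF assms(2)])
    assume "ties n y = 0"
    then have "\<bar>real (ties n y) - m * ?p\<bar> = m * ?p"
      using m p by simp
    then show ?thesis
      using p m by (simp add: mult_left_mono mult_left_le)
  next
    assume "ties n y = 2 * (n choose 2)"
    then have "real (ties n y) - m * ?p = m * (1 - ?p)"
      by (simp add: m_def algebra_simps)
    then have "\<bar>real (ties n y) - m * ?p\<bar> = m * (1 - ?p)"
      using m p by simp
    then show ?thesis
      using p m by (simp add: mult_left_mono mult_left_le_one_le)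
  qed
  finally show ?thesis
    using assms(1) by (simp add: standardized_ties_def m_def abs_divide power2_eq_square pos_le_divide_eq)
qed

lemma mle_le_iff_standardized_ties_le:
  assumes est: "is_mle (networks n) (\<lambda>\<alpha>. bernoulli_lik n (\<alpha> - c)) est"
    and y: "y \<in> networks n" and ties: "0 < ties n y" "ties n y < 2 * (n choose 2)"
    and r: "r > 0" and sd: "ties_sd n (\<theta> - c) > 0"
  shows "r * (est y - \<theta>) \<le> x \<longleftrightarrow>
    standardized_ties n (\<theta> - c) y
      \<le> ties_sd n (\<theta> - c) * ((exp (x / r) - 1) / (1 + logistic (\<theta> - c) * (exp (x / r) - 1)))"
    (is "_ \<longleftrightarrow> _ \<le> ?z")
proof -
  define m where "m = real (2 * (n choose 2))"
  let ?s = "ties_sd n (\<theta> - c)" and ?p = "logistic (\<theta> - c)"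
  have m: "m > 0"
    unfolding m_def of_nat_0_less_iff using ties by linarith
  have "m * (logistic (\<theta> - c + x / r) - ?p) = ?s * ?z"
  proof -
    have "?s * ?s = m * (?p * (1 - ?p))"
      using logistic_bounds[of "\<theta> - c"] by (simp add: ties_sd_def m_def less_imp_le)
    then show ?thesis
      unfolding logistic_diff by (metis (no_types, lifting) mult.assoc)
  qed
  then have z: "m * logistic (\<theta> - c + x / r) = ?s * ?z + m * ?p"
    by (simp add: algebra_simps)
  have "r * (est y - \<theta>) \<le> x \<longleftrightarrow> est y - c \<le> \<theta> - c + x / r"
    using r by (simp add: field_simps)
  also have "\<dots> \<longleftrightarrow> m * logistic (est y - c) \<le> m * logistic (\<theta> - c + x / r)"
    using m by (simp add: logistic_le_iff)
  also have "m * logistic (est y - c) = ties n y"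
    unfolding m_def by (rule mle_score_equation[OF est y ties])
  also have "real (ties n y) \<le> m * logistic (\<theta> - c + x / r)
      \<longleftrightarrow> standardized_ties n (\<theta> - c) y \<le> ?z"
    unfolding z standardized_ties_def m_def[symmetric]
    using sd by (simp add: pos_divide_le_eq algebra_simps)
  finally show ?thesis .
qed

text \<open>
  The exponential increment is asymptotic to \<open>x / r n\<close>, so that the product behaves like
  \<open>s n / r n * x\<close>; the denominator tends to \<open>1\<close> because \<open>p\<close> is bounded.
\<close>

lemma critical_value_tendsto:
  fixes s r p :: "nat \<Rightarrow> real"
  assumes r: "filterlim r at_top sequentially"
    and ratio: "(\<lambda>n. s n / r n) \<longlonglongrightarrow> \<kappa>"
    and p: "\<And>n. \<bar>p n\<bar> \<le> 1"
  shows "(\<lambda>n. s n * ((exp (x / r n) - 1) / (1 + p n * (exp (x / r n) - 1)))) \<longlonglongrightarrow> \<kappa> * x"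
proof -
  have "((\<lambda>r::real. r * (exp (x / r) - 1)) \<longlongrightarrow> x) at_top"
    by real_asymp
  from filterlim_compose[OF this r]
  have lin: "(\<lambda>n. r n * (exp (x / r n) - 1)) \<longlonglongrightarrow> x" .
  have "((\<lambda>r::real. exp (x / r) - 1) \<longlongrightarrow> 0) at_top"
    by real_asymp
  from filterlim_compose[OF this r]
  have null: "(\<lambda>n. exp (x / r n) - 1) \<longlonglongrightarrow> 0" .
  have "(\<lambda>n. p n * (exp (x / r n) - 1)) \<longlonglongrightarrow> 0"
    by (rule tendsto_0_le[OF null, of _ 1])
       (use p in \<open>auto simp: abs_mult intro!: always_eventually mult_left_le_one_le\<close>)
  then have "(\<lambda>n. s n / r n * (r n * (exp (x / r n) - 1)) / (1 + p n * (exp (x / r n) - 1))) \<longlonglongrightarrow> \<kappa> * x / (1 + 0)"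
    by (intro tendsto_intros ratio lin) auto
  moreover have "\<forall>\<^sub>F n in sequentially. r n > 0"
    using r unfolding filterlim_at_top_dense by blast
  then have "\<forall>\<^sub>F n in sequentially.
      s n / r n * (r n * (exp (x / r n) - 1)) / (1 + p n * (exp (x / r n) - 1))
      = s n * ((exp (x / r n) - 1) / (1 + p n * (exp (x / r n) - 1)))"
    by eventually_elim simp
  ultimately show ?thesis
    using Lim_transform_eventually by fastforce
qed

lemma (in prob_space) abs_prob_diff_le_prob:
  assumes "A \<in> events" "B \<in> events" "C \<in> events"
    and "\<And>\<omega>. \<omega> \<in> space M \<Longrightarrow> \<omega> \<notin> C \<Longrightarrow> \<omega> \<in> A \<longleftrightarrow> \<omega> \<in> B"
  shows "\<bar>prob A - prob B\<bar> \<le> prob C"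
proof -
  have "prob A \<le> prob (B \<union> C)" "prob B \<le> prob (A \<union> C)"
    using assms sets.sets_into_space by (fastforce intro!: finite_measure_mono)+
  with measure_Un_le[OF assms(2,3)] measure_Un_le[OF assms(1,3)] show ?thesis
    by linarith
qed

text \<open>
  The asymptotics of the estimator for an arbitrary sequence of offsets. The number \<open>\<kappa>\<^sup>2\<close> is the
  limit of the Fisher information about \<open>\<theta>\<close> divided by the squared rate, since the variance of the
  score is the variance of the number of ties.
\<close>

theorem offset_bernoulli_mle_asymptotically_normal:
  fixes \<theta> \<kappa> :: real and c r :: "nat \<Rightarrow> real"
  assumes est: "\<And>n. is_mle (networks n) (\<lambda>\<alpha>. bernoulli_lik n (\<alpha> - c n)) (est n)"
    and r: "filterlim r at_top sequentially"
    and ratio: "(\<lambda>n. ties_sd n (\<theta> - c n) / r n) \<longlonglongrightarrow> \<kappa>" and \<kappa>: "\<kappa> > 0"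
  defines "M \<equiv> \<lambda>n. bernoulli_model n (\<theta> - c n)"
  shows "rate_consistent r M est \<theta>"
    and "converges_in_distribution M (\<lambda>n y. r n * (est n y - \<theta>)) (normal_distribution 0 (inverse (\<kappa>\<^sup>2)))"
proof -
  define s where "s n = ties_sd n (\<theta> - c n)" for n
  define Z where "Z n = standardized_ties n (\<theta> - c n)" for n
  define X where "X n y = r n * (est n y - \<theta>)" for n y
  have prob: "prob_space (M n)" for n
    by (simp add: M_def prob_space_bernoulli_model)
  have measurable: "W \<in> borel_measurable (M n)" for n and W :: "_ \<Rightarrow> real"
    by (simp add: M_def borel_measurable_bernoulli_model)
  have events: "A \<in> sets (M n)" if "A \<subseteq> space (M n)" for A n
    using that by (simp add: M_def bernoulli_model_def sets_point_measure space_point_measure)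
  have s: "filterlim s at_top sequentially"
  proof -
    have "filterlim (\<lambda>n. s n / r n * r n) at_top sequentially"
      using filterlim_tendsto_pos_mult_at_top[OF ratio \<kappa> r] by (simp add: s_def)
    moreover have "\<forall>\<^sub>F n in sequentially. s n / r n * r n = s n"
      using r unfolding filterlim_at_top_dense by (auto elim!: allE[of _ 0] eventually_mono)
    ultimately show ?thesis
      by (rule filterlim_cong[OF refl refl, THEN iffD1, rotated])
  qed
  have clt: "converges_in_distribution M Z std_normal_distribution"
    unfolding M_def Z_def by (rule standardized_ties_clt) (use s in \<open>simp add: s_def[abs_def]\<close>)
  have normal: "real_distribution (normal_distribution 0 v)" "measure (normal_distribution 0 v) {x} = 0"
    if "v > 0" for v x
    using that unfolding normal_distribution_def real_distribution_def real_distribution_axioms_def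
    by (auto simp: prob_space_normal_density measure_density_lborel_singleton)
  have std: "normal_distribution 0 1 = std_normal_distribution"
    by (simp add: normal_distribution_def)
  note std_normal = normal[of 1, unfolded std, simplified]

  \<comment> \<open>The set contains all networks on which the likelihood has no maximizer.\<close>
  have boundary: "(\<lambda>n. measure (M n) {y \<in> space (M n). \<bar>Z n y\<bar> \<ge> s n}) \<longlonglongrightarrow> 0"
    by (intro bounded_in_probability_imp_tail_tendsto_0 s prob measurable
        converges_in_distribution_imp_bounded_in_probability[OF _ _ std_normal clt])
  have lim: "(\<lambda>n. measure (M n) {y \<in> space (M n). X n y \<le> x}) \<longlonglongrightarrow> cdf std_normal_distribution (\<kappa> * x)" for x
  proof -
    define z where "z n = s n * ((exp (x / r n) - 1) / (1 + logistic (\<theta> - c n) * (exp (x / r n) - 1)))" for n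
    have "z \<longlonglongrightarrow> \<kappa> * x"
      unfolding z_def[abs_def] using ratio logistic_bounds
      by (intro critical_value_tendsto r) (auto simp: s_def abs_le_iff less_imp_le intro: order_trans[of _ 0])
    then have main: "(\<lambda>n. measure (M n) {y \<in> space (M n). Z n y \<le> z n}) \<longlonglongrightarrow> cdf std_normal_distribution (\<kappa> * x)"
      by (intro converges_in_distribution_prob_le prob measurable std_normal clt)
    have "\<forall>\<^sub>F n in sequentially. r n > 0" "\<forall>\<^sub>F n in sequentially. s n > 0"
      using r s unfolding filterlim_at_top_dense by blast+
    then have "\<forall>\<^sub>F n in sequentially.
        norm (measure (M n) {y \<in> space (M n). X n y \<le> x} - measure (M n) {y \<in> space (M n). Z n y \<le> z n})
          \<le> measure (M n) {y \<in> space (M n). \<bar>Z n y\<bar> \<ge> s n}"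
    proof eventually_elim
      case (elim n)
      interpret prob_space "M n"
        by (rule prob)
      have "X n y \<le> x \<longleftrightarrow> Z n y \<le> z n" if y: "y \<in> space (M n)" and "\<not> \<bar>Z n y\<bar> \<ge> s n" for y
      proof -
        have y: "y \<in> networks n"
          using y by (simp add: M_def space_bernoulli_model)
        have "\<not> (ties n y = 0 \<or> ties n y = 2 * (n choose 2))"
          using boundary_imp_standardized_ties_large[of n "\<theta> - c n" y] elim that(2)
          unfolding s_def Z_def by blast
        then have "0 < ties n y" "ties n y < 2 * (n choose 2)"
          using ties_le[OF y] by linarith+
        then show ?thesis
          using mle_le_iff_standardized_ties_le[OF est y] elim
          unfolding s_def Z_def X_def z_def by blast
      qed
      then show ?case
        unfolding real_norm_def by (intro abs_prob_diff_le_prob events) auto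
    qed
    from Lim_null_comparison[OF this boundary] main show ?thesis
      by (rule Lim_transform[rotated])
  qed

  have v: "inverse (\<kappa>\<^sup>2) > 0"
    using \<kappa> by simp
  show conv: "converges_in_distribution M (\<lambda>n y. r n * (est n y - \<theta>)) (normal_distribution 0 (inverse (\<kappa>\<^sup>2)))"
    using lim unfolding X_def
    by (simp add: converges_in_distribution_def weak_conv_m_def weak_conv_def cdf_distr_eq measurable
        cdf_normal_distribution[OF \<kappa>])
  show "rate_consistent r M est \<theta>"
    unfolding rate_consistent_def
    by (rule converges_in_distribution_imp_bounded_in_probability[OF prob measurable normal[OF v] conv])
qed

lemma real_choose_2: "real (n choose 2) = real n * (real n - 1) / 2"
  by (induction n) (simp_all add: numeral_2_eq_2 field_simps)

lemma sqrt_choose_2_at_top: "filterlim (\<lambda>n. sqrt (real (n choose 2))) at_top sequentially"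
proof (rule filterlim_compose[OF sqrt_at_top])
  have "filterlim (\<lambda>n. real n * (real n - 1) / 2) at_top sequentially"
    by real_asymp
  then show "filterlim (\<lambda>n. real (n choose 2)) at_top sequentially"
    by (simp add: real_choose_2)
qed

lemma ties_sd_eq: "ties_sd n \<alpha> = sqrt (real (n choose 2)) * sqrt (2 * exp \<alpha> / (1 + exp \<alpha>)\<^sup>2)"
  unfolding ties_sd_def one_minus_logistic
  by (simp add: logistic_def real_sqrt_mult[symmetric] power2_eq_square)

text \<open>
  With success probability \<open>(exp \<alpha> / n) / (1 + exp \<alpha> / n)\<close> and \<open>n (n - 1)\<close> ordered pairs, the variance of
  the number of ties is \<open>(n - 1) exp \<alpha> / (1 + exp \<alpha> / n)\<^sup>2\<close>.
\<close>

lemma sparse_ties_sd_ratio: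
  "(\<lambda>n. ties_sd n (\<alpha> - ln (real n)) / sqrt (real n)) \<longlonglongrightarrow> exp (\<alpha> / 2)"
proof -
  let ?e = "exp \<alpha>"
  have "(\<lambda>n. (real n - 1) / real n * ?e / (1 + ?e / real n)\<^sup>2) \<longlonglongrightarrow> 1 * ?e / (1 + 0)\<^sup>2"
    by (intro tendsto_intros) (real_asymp | simp)+
  then have lim: "(\<lambda>n. sqrt ((real n - 1) / real n * ?e / (1 + ?e / real n)\<^sup>2)) \<longlonglongrightarrow> sqrt (1 * ?e / (1 + 0)\<^sup>2)"
    by (rule tendsto_real_sqrt)
  have limit_eq: "sqrt (1 * ?e / (1 + 0)\<^sup>2) = exp (\<alpha> / 2)"
    by (rule real_sqrt_unique) (simp_all add: exp_double[symmetric])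
  have "\<forall>\<^sub>F n in sequentially. sqrt ((real n - 1) / real n * ?e / (1 + ?e / real n)\<^sup>2)
      = ties_sd n (\<alpha> - ln (real n)) / sqrt (real n)"
    using eventually_gt_at_top[of 0]
    by eventually_elim
      (simp add: ties_sd_eq exp_diff real_choose_2 real_sqrt_mult[symmetric] real_sqrt_divide[symmetric])
  from Lim_transform_eventually[OF lim this] show ?thesis
    unfolding limit_eq .
qed

text \<open>
  The limits of \<open>s\<^sub>n / r\<^sub>n\<close> for the two choices of offset and rate are \<open>sqrt (2 exp \<alpha>\<^sub>0 / (1 + exp \<alpha>\<^sub>0)\<^sup>2)\<close>
  and \<open>exp (\<alpha>\<^sub>0 / 2)\<close>.
\<close>

theorem theorem3p1:
  fixes \<alpha>_min \<alpha>_max \<alpha>\<^sub>0 :: real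
    and \<alpha>_hat \<alpha>_hat_dag :: "nat \<Rightarrow> (nat \<Rightarrow> nat \<Rightarrow> nat) \<Rightarrow> real"
  assumes "\<alpha>_min \<le> \<alpha>_max" and "\<alpha>\<^sub>0 \<in> {\<alpha>_min..\<alpha>_max}"
    and "\<And>n. is_mle (networks n) (bernoulli_lik n) (\<alpha>_hat n)"
    and "\<And>n. is_mle (networks n) (sparse_bernoulli_lik n) (\<alpha>_hat_dag n)"
  shows "(rate_consistent (\<lambda>n. sqrt (real (n choose 2)))
            (\<lambda>n. bernoulli_model n \<alpha>\<^sub>0) \<alpha>_hat \<alpha>\<^sub>0 \<and>
          converges_in_distribution (\<lambda>n. bernoulli_model n \<alpha>\<^sub>0)
            (\<lambda>n y. sqrt (real (n choose 2)) * (\<alpha>_hat n y - \<alpha>\<^sub>0))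
            (normal_distribution 0 (inverse (2 * exp \<alpha>\<^sub>0 / (1 + exp \<alpha>\<^sub>0)\<^sup>2))))
       \<and> (rate_consistent (\<lambda>n. sqrt (real n))
            (\<lambda>n. sparse_bernoulli_model n \<alpha>\<^sub>0) \<alpha>_hat_dag \<alpha>\<^sub>0 \<and>
          converges_in_distribution (\<lambda>n. sparse_bernoulli_model n \<alpha>\<^sub>0)
            (\<lambda>n y. sqrt (real n) * (\<alpha>_hat_dag n y - \<alpha>\<^sub>0))
            (normal_distribution 0 (exp (- \<alpha>\<^sub>0))))"
proof -
  define \<kappa> where "\<kappa> = sqrt (2 * exp \<alpha>\<^sub>0 / (1 + exp \<alpha>\<^sub>0)\<^sup>2)"
  have \<kappa>: "\<kappa> > 0"
    using one_plus_exp_pos[of \<alpha>\<^sub>0] by (simp add: \<kappa>_def)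
  have \<kappa>_sq: "\<kappa>\<^sup>2 = 2 * exp \<alpha>\<^sub>0 / (1 + exp \<alpha>\<^sub>0)\<^sup>2"
    by (simp add: \<kappa>_def)
  have dense_ratio: "(\<lambda>n. ties_sd n (\<alpha>\<^sub>0 - 0) / sqrt (real (n choose 2))) \<longlonglongrightarrow> \<kappa>"
  proof (rule tendsto_eventually)
    show "\<forall>\<^sub>F n in sequentially. ties_sd n (\<alpha>\<^sub>0 - 0) / sqrt (real (n choose 2)) = \<kappa>"
      using eventually_ge_at_top[of 2]
      by eventually_elim (simp add: ties_sd_eq \<kappa>_def)
  qed
  have dense_mle: "is_mle (networks n) (\<lambda>\<alpha>. bernoulli_lik n (\<alpha> - 0)) (\<alpha>_hat n)" for n
    using assms(3)[of n] by simp
  note dense = offset_bernoulli_mle_asymptotically_normal[OF dense_mle sqrt_choose_2_at_top dense_ratio \<kappa>]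

  have sparse_mle: "is_mle (networks n) (\<lambda>\<alpha>. bernoulli_lik n (\<alpha> - ln (real n))) (\<alpha>_hat_dag n)" for n
    using assms(4)[of n] by (simp add: sparse_bernoulli_lik_def[abs_def])
  have sqrt_n: "filterlim (\<lambda>n. sqrt (real n)) at_top sequentially"
    by (rule filterlim_compose[OF sqrt_at_top filterlim_real_sequentially])
  note sparse = offset_bernoulli_mle_asymptotically_normal[OF sparse_mle sqrt_n sparse_ties_sd_ratio[of \<alpha>\<^sub>0] exp_gt_zero]
  have "inverse ((exp (\<alpha>\<^sub>0 / 2))\<^sup>2) = exp (- \<alpha>\<^sub>0)"
    by (simp add: exp_double[symmetric] exp_minus)
  with dense sparse show ?thesis
    by (simp add: \<kappa>_sq sparse_bernoulli_model_eq)
qed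

end
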